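(* Let $G$ and $H$ be da-hypomorphs of a graph or digraph. (a) Either (1) every pair of dacards in their common dadeck (obtained by deleting two distinct vertices) is dapasted isomorphically in $G$ and $H$, or (2) no pair of dacards in their common dadeck is dapasted isomorphically in $G$ and $H$. (b) If (1) holds then $G\cong H$, and if (2) holds then $G\not\cong H$.
   Context: Digraphs are finite, without loops or multiple arcs; for distinct vertices $x,y$ both $xy$ and $yx$ may be arcs (together a biarc); an arc whose reverse is absent is an unpaired arc. A graph is regarded as a digraph in which every edge is a biarc. For a vertex $x$ of a digraph $D$, a vertex $w$ is an out-neighbor (in-neighbor) of $x$ if $xw$ ($wx$) is an unpaired arc, and a strong neighbor if $xw,wx$ are both arcs. The degree triple $\mathrm{dt}_D(x)=(a,b,c)$ consists of the numbers of out-, in- and strong neighbors of $x$. A dacard of $D$ is a pair $(D-x,\mathrm{dt}_D(x))$ with $D-x$ taken up to isomorphism; two dacards are identical if the digraphs are isomorphic and the triples are equal. $\mathrm{Dadeck}(D)$ is the multiset of dacards of $D$; $D$ and $H$ are da-hypomorphs if they have the same dadeck. Dapasting: let $(A,\alpha)$, $(B,\beta)$ be dacards of $G$ obtained by deleting distinct vertices of $G$. A dapasting of them as members of $\mathrm{Dadeck}(G)$ is a digraph $P$ with two distinct non-adjacent vertices $u,v$, $u$ labeled $(e,\alpha)$ and $v$ labeled $(e,\beta)$ (others unlabeled), such that $P-u\cong A$, $P-v\cong B$, and there is $Y\in\{P,P+uv,P+vu,P+uv+vu\}$ ($P+xy$ = $P$ with arc $xy$ added) with $\mathrm{dt}_Y(u)=\alpha$,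 $\mathrm{dt}_Y(v)=\beta$ and $Y$ da-hypomorphic to $G$; any digraph isomorphic to such $Y$ is a completion of $P$. $P$ is a dapasting in $J$ if $J$ is a completion of $P$. Two dapastings are isomorphic if there is a digraph isomorphism between them preserving labels. For da-hypomorphs $G,H$, dacards $A,B$ (of the common dadeck) are dapasted isomorphically in $G$ and $H$ if there are a dapasting of $A,B$ in $G$ and a dapasting of $A,B$ in $H$ (both as members of the common dadeck) which are isomorphic as dapastings.
   Formalization: G is assumed to have at least two vertices: with fewer there is no pair of dacards, so (1) and (2) both hold vacuously while G ≅ H, and the second half of (b) fails. *)

theory Defs
  imports "Graph_Theory.Graph_Theory" "HOL-Library.Multiset"
begin

section \<open>Degree triples, dacards and dadecks\<close>

text \<open>The locale \<^locale>\<open>digraph\<close> is exactly the class of finite digraphs without loops or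
  multiple arcs. A graph is the special case \<^locale>\<open>graph\<close>, in which every edge is a biarc.\<close>

type_synonym degree_triple = "nat \<times> nat \<times> nat"

definition out_nbrs :: "('a, 'b) pre_digraph \<Rightarrow> 'a \<Rightarrow> 'a set" where
  "out_nbrs D x = {w \<in> verts D. x \<rightarrow>\<^bsub>D\<^esub> w \<and> \<not> w \<rightarrow>\<^bsub>D\<^esub> x}"

definition in_nbrs :: "('a, 'b) pre_digraph \<Rightarrow> 'a \<Rightarrow> 'a set" where
  "in_nbrs D x = {w \<in> verts D. w \<rightarrow>\<^bsub>D\<^esub> x \<and> \<not> x \<rightarrow>\<^bsub>D\<^esub> w}"

definition strong_nbrs :: "('a, 'b) pre_digraph \<Rightarrow> 'a \<Rightarrow> 'a set" where
  "strong_nbrs D x = {w \<in> verts D. x \<rightarrow>\<^bsub>D\<^esub> w \<and> w \<rightarrow>\<^bsub>D\<^esub> x}"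

definition dt :: "('a, 'b) pre_digraph \<Rightarrow> 'a \<Rightarrow> degree_triple" where
  "dt D x = (card (out_nbrs D x), card (in_nbrs D x), card (strong_nbrs D x))"

text \<open>A digraph up to isomorphism. Since every finite digraph without multiple arcs is isomorphic
  to one whose vertices are natural numbers and whose arcs are pairs of vertices, the class is
  represented by the set of its members of that form; this makes it comparable
  across different vertex types (see \<open>iso_class_eq_iff\<close> below).\<close>

type_synonym digraph_class = "nat pair_pre_digraph set"

definition iso_class :: "('a, 'b) pre_digraph \<Rightarrow> digraph_class" where
  "iso_class D = {K. digraph_iso D (with_proj K)}"

lemma digraph_iso_trans:
  assumes "digraph_iso D E" "digraph_iso E F"
  shows "digraph_iso D F"
proof -
  obtain f where f: "pre_digraph.digraph_isomorphism D f" "E = app_iso f D"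
    using assms(1) unfolding digraph_iso_def by blast
  obtain g where g: "pre_digraph.digraph_isomorphism E g" "F = app_iso g E"
    using assms(2) unfolding digraph_iso_def by blast
  define h where "h = \<lparr>iso_verts = iso_verts g \<circ> iso_verts f, iso_arcs = iso_arcs g \<circ> iso_arcs f,
    iso_head = iso_head g, iso_tail = iso_tail g\<rparr>"
  have "pre_digraph.digraph_isomorphism D h"
    using f g unfolding pre_digraph.digraph_isomorphism_def h_def
    by (auto intro!: comp_inj_on)
  moreover have "F = app_iso h D"
    using f g by (auto simp: app_iso_def h_def image_comp)
  ultimately show ?thesis unfolding digraph_iso_def by blast
qed

lemma digraph_iso_sym:
  assumes "digraph_iso D E"
  shows "digraph_iso E D"
proof -
  obtain f where f: "pre_digraph.digraph_isomorphism D f" "E = app_iso f D"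
    using assms unfolding digraph_iso_def by blast
  have "wf_digraph D" using f(1) unfolding pre_digraph.digraph_isomorphism_def by blast
  then have "pre_digraph.digraph_isomorphism E (pre_digraph.inv_iso D f)"
    using f wf_digraph.digraph_isomorphism_invI by blast
  moreover have "D = app_iso (pre_digraph.inv_iso D f) E"
    using f pre_digraph.app_iso_inv by metis
  ultimately show ?thesis unfolding digraph_iso_def by blast
qed

lemma iso_class_nonempty:
  assumes "digraph D"
  shows "iso_class D \<noteq> {}"
proof -
  interpret digraph D by fact
  obtain r :: "'a \<Rightarrow> nat" where r: "inj_on r (verts D)"
    using finite_imp_inj_to_nat_seg[OF finite_verts] by metis
  define ra where "ra a = (r (tail D a), r (head D a))" for a
  define K where "K = \<lparr>pverts = r ` verts D, parcs = ra ` arcs D\<rparr>"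
  define f where "f = \<lparr>iso_verts = r, iso_arcs = ra, iso_head = snd, iso_tail = fst\<rparr>"
  have "inj_on ra (arcs D)"
  proof (rule inj_onI)
    fix a b assume ab: "a \<in> arcs D" "b \<in> arcs D" "ra a = ra b"
    then have "tail D a = tail D b" "head D a = head D b"
      using inj_onD[OF r] by (auto simp: ra_def)
    then show "a = b" using ab no_multi_arcs by (simp add: arc_to_ends_def)
  qed
  then have "digraph_isomorphism f"
    using r wf_digraph by (auto simp: digraph_isomorphism_def f_def ra_def)
  moreover have "with_proj K = app_iso f D"
    by (simp add: with_proj_def app_iso_def K_def f_def)
  ultimately show ?thesis unfolding iso_class_def digraph_iso_def by blast
qed

lemma iso_class_eq_iff:
  assumes "digraph D"
  shows "iso_class D = iso_class E \<longleftrightarrow> digraph_iso D E"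
proof
  assume eq: "iso_class D = iso_class E"
  obtain K where "K \<in> iso_class D" using iso_class_nonempty[OF assms] by blast
  with eq have "digraph_iso D (with_proj K)" "digraph_iso E (with_proj K)"
    by (auto simp: iso_class_def)
  then show "digraph_iso D E" by (metis digraph_iso_sym digraph_iso_trans)
next
  assume DE: "digraph_iso D E"
  then show "iso_class D = iso_class E"
    unfolding iso_class_def using digraph_iso_sym[OF DE] digraph_iso_trans[OF DE]
      digraph_iso_trans[OF digraph_iso_sym[OF DE]] by blast
qed

type_synonym dacard = "digraph_class \<times> degree_triple"

definition dacard_at :: "('a, 'b) pre_digraph \<Rightarrow> 'a \<Rightarrow> dacard" where
  "dacard_at D x = (iso_class (pre_digraph.del_vert D x), dt D x)"

definition dadeck :: "('a, 'b) pre_digraph \<Rightarrow> dacard multiset" where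
  "dadeck D = image_mset (dacard_at D) (mset_set (verts D))"

definition da_hypomorphs :: "('a, 'b) pre_digraph \<Rightarrow> ('c, 'd) pre_digraph \<Rightarrow> bool" where
  "da_hypomorphs D H \<longleftrightarrow> dadeck D = dadeck H"

definition dacard_pair :: "('a, 'b) pre_digraph \<Rightarrow> dacard \<Rightarrow> dacard \<Rightarrow> bool" where
  "dacard_pair G c d \<longleftrightarrow>
    (\<exists>x \<in> verts G. \<exists>y \<in> verts G. x \<noteq> y \<and> c = dacard_at G x \<and> d = dacard_at G y)"


section \<open>Dapastings\<close>

text \<open>As with isomorphism classes, nothing is lost by letting dapastings have natural numbers as
  vertices. Below, \<open>c\<close> is the dacard $(A,\alpha)$, \<open>d\<close> is the dacard $(B,\beta)$, and a
  dapasting is the digraph \<open>P\<close> with its two distinguished vertices \<open>u\<close> and \<open>v\<close>.\<close>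

definition arc_extensions ::
    "nat pair_pre_digraph \<Rightarrow> nat \<Rightarrow> nat \<Rightarrow> (nat, nat \<times> nat) pre_digraph set" where
  "arc_extensions P u v =
    {with_proj P,
     pre_digraph.add_arc (with_proj P) (u, v),
     pre_digraph.add_arc (with_proj P) (v, u),
     pre_digraph.add_arc (pre_digraph.add_arc (with_proj P) (u, v)) (v, u)}"

definition completes :: "('a, 'b) pre_digraph \<Rightarrow> dacard \<Rightarrow> dacard \<Rightarrow>
    nat pair_pre_digraph \<Rightarrow> nat \<Rightarrow> nat \<Rightarrow> (nat, nat \<times> nat) pre_digraph \<Rightarrow> bool" where
  "completes G c d P u v Y \<longleftrightarrow>
    Y \<in> arc_extensions P u v \<and> dt Y u = snd c \<and> dt Y v = snd d \<and> da_hypomorphs Y G"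

definition dapasting :: "('a, 'b) pre_digraph \<Rightarrow> dacard \<Rightarrow> dacard \<Rightarrow>
    nat pair_pre_digraph \<Rightarrow> nat \<Rightarrow> nat \<Rightarrow> bool" where
  "dapasting G c d P u v \<longleftrightarrow>
    dacard_pair G c d \<and> pair_digraph P \<and>
    u \<in> pverts P \<and> v \<in> pverts P \<and> u \<noteq> v \<and> (u, v) \<notin> parcs P \<and> (v, u) \<notin> parcs P \<and>
    iso_class (pre_digraph.del_vert (with_proj P) u) = fst c \<and>
    iso_class (pre_digraph.del_vert (with_proj P) v) = fst d \<and>
    (\<exists>Y. completes G c d P u v Y)"

definition completion :: "('a, 'b) pre_digraph \<Rightarrow> dacard \<Rightarrow> dacard \<Rightarrow>
    nat pair_pre_digraph \<Rightarrow> nat \<Rightarrow> nat \<Rightarrow> ('c, 'd) pre_digraph \<Rightarrow> bool" where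
  "completion G c d P u v J \<longleftrightarrow> (\<exists>Y. completes G c d P u v Y \<and> digraph_iso Y J)"

definition dapasting_in :: "('a, 'b) pre_digraph \<Rightarrow> dacard \<Rightarrow> dacard \<Rightarrow>
    nat pair_pre_digraph \<Rightarrow> nat \<Rightarrow> nat \<Rightarrow> ('c, 'd) pre_digraph \<Rightarrow> bool" where
  "dapasting_in G c d P u v J \<longleftrightarrow> dapasting G c d P u v \<and> completion G c d P u v J"

text \<open>The label $(e,\alpha)$ consists of a fixed tag $e$ and a triple; it is represented by the
  triple alone. \<^const>\<open>None\<close> stands for an unlabeled vertex. In particular the two
  labeled vertices may be interchanged by an isomorphism if their triples agree.\<close>

definition dapasting_labels :: "dacard \<Rightarrow> dacard \<Rightarrow> nat \<Rightarrow> nat \<Rightarrow> nat \<Rightarrow> degree_triple option" where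
  "dapasting_labels c d u v = [u \<mapsto> snd c, v \<mapsto> snd d]"

definition labeled_iso ::
    "('a, 'b) pre_digraph \<Rightarrow> ('a \<Rightarrow> 'l) \<Rightarrow> ('c, 'd) pre_digraph \<Rightarrow> ('c \<Rightarrow> 'l) \<Rightarrow> bool" where
  "labeled_iso P L Q M \<longleftrightarrow>
    (\<exists>f. pre_digraph.digraph_isomorphism P f \<and> Q = app_iso f P \<and>
      (\<forall>w \<in> verts P. M (iso_verts f w) = L w))"

definition dapasted_isomorphically ::
    "('a, 'b) pre_digraph \<Rightarrow> ('c, 'd) pre_digraph \<Rightarrow> dacard \<Rightarrow> dacard \<Rightarrow> bool" where
  "dapasted_isomorphically G H c d \<longleftrightarrow>
    (\<exists>P u v Q s t.
      dapasting_in G c d P u v G \<and> dapasting_in H c d Q s t H \<and>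
      labeled_iso (with_proj P) (dapasting_labels c d u v)
                  (with_proj Q) (dapasting_labels c d s t))"

end

theory Submission
  imports Defs
begin

text \<open>Deleting the arcs between \<open>u\<close> and \<open>v\<close> from a copy of $G \cong H$ gives one dapasting that
  serves both digraphs. Conversely, the degree triple of \<open>u\<close> in a completion, compared with the one
  in the dapasting, tells which arcs were added between \<open>u\<close> and \<open>v\<close>. So a dapasting has at most one
  completion, and a label-preserving isomorphism of dapastings extends to their completions; this
  holds even if it interchanges the labeled vertices, because the two triples then agree.\<close>

section \<open>Isomorphism invariance of the dadeck\<close>

lemma dominates_app_iso_iff:
  assumes "pre_digraph.digraph_isomorphism D f" "x \<in> verts D" "y \<in> verts D"
  shows "iso_verts f x \<rightarrow>\<^bsub>app_iso f D\<^esub> iso_verts f y \<longleftrightarrow> x \<rightarrow>\<^bsub>D\<^esub> y"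
proof -
  interpret wf_digraph D using assms(1) by (simp add: pre_digraph.digraph_isomorphism_def)
  show ?thesis
  proof
    assume "iso_verts f x \<rightarrow>\<^bsub>app_iso f D\<^esub> iso_verts f y"
    then obtain x' y' where xy: "x' \<rightarrow>\<^bsub>D\<^esub> y'" "iso_verts f x = iso_verts f x'" "iso_verts f y = iso_verts f y'"
      unfolding arcs_ends_app_iso_eq[OF assms(1)] by auto
    then have "x = x'" "y = y'"
      using iso_verts_eq_iff[OF assms(1)] assms(2,3) adj_in_verts[OF xy(1)] by metis+
    with xy(1) show "x \<rightarrow>\<^bsub>D\<^esub> y" by simp
  qed (auto simp: arcs_ends_app_iso_eq[OF assms(1)])
qed

lemma dt_app_iso:
  assumes "pre_digraph.digraph_isomorphism D f" "x \<in> verts D"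
  shows "dt (app_iso f D) (iso_verts f x) = dt D x"
proof -
  have inj: "inj_on (iso_verts f) (verts D)"
    using assms(1) by (rule pre_digraph.digraph_isomorphism_inj_on_verts)
  note iff = dominates_app_iso_iff[OF assms(1)]
  have "out_nbrs (app_iso f D) (iso_verts f x) = iso_verts f ` out_nbrs D x"
    using iff assms(2) by (auto simp: out_nbrs_def)
  moreover have "in_nbrs (app_iso f D) (iso_verts f x) = iso_verts f ` in_nbrs D x"
    using iff assms(2) by (auto simp: in_nbrs_def)
  moreover have "strong_nbrs (app_iso f D) (iso_verts f x) = iso_verts f ` strong_nbrs D x"
    using iff assms(2) by (auto simp: strong_nbrs_def)
  moreover have "inj_on (iso_verts f) (out_nbrs D x)" "inj_on (iso_verts f) (in_nbrs D x)"
    "inj_on (iso_verts f) (strong_nbrs D x)"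
    by (auto simp: out_nbrs_def in_nbrs_def strong_nbrs_def intro: inj_on_subset[OF inj])
  ultimately show ?thesis by (simp add: dt_def card_image)
qed

text \<open>Arcs incident with \<open>x\<close> correspond to arcs incident with its image, so the
  record \<open>f\<close> itself, restricted to the smaller digraph, carries one card onto the
  other.\<close>

lemma digraph_iso_del_vert:
  assumes "pre_digraph.digraph_isomorphism D f" "x \<in> verts D"
  shows "digraph_iso (pre_digraph.del_vert D x)
    (pre_digraph.del_vert (app_iso f D) (iso_verts f x))"
proof -
  interpret wf_digraph D using assms(1) by (simp add: pre_digraph.digraph_isomorphism_def)
  have "pre_digraph.digraph_isomorphism (del_vert x) f"
    using assms(1) wf_digraph_del_vert[of x]
    by (auto simp: pre_digraph.digraph_isomorphism_def del_vert_simps intro: inj_on_subset)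
  moreover have "pre_digraph.del_vert (app_iso f D) (iso_verts f x) = app_iso f (del_vert x)"
    using assms
    by (intro pre_digraph.equality)
      (auto simp: pre_digraph.del_vert_def iso_verts_tail iso_verts_head)
  ultimately show ?thesis unfolding digraph_iso_def by blast
qed

text \<open>Makes \<open>iso_class_eq_iff\<close> applicable to the cards.\<close>

lemma digraph_del_vert:
  assumes "digraph D"
  shows "digraph (pre_digraph.del_vert D x)"
proof -
  interpret digraph D by fact
  interpret del: fin_digraph "del_vert x" by (rule fin_digraph_del_vert)
  show ?thesis
    by unfold_locales (use no_loops no_multi_arcs in \<open>auto simp: del_vert_simps arc_to_ends_def\<close>)
qed

lemma dacard_at_app_iso:
  assumes "digraph D" "pre_digraph.digraph_isomorphism D f" "x \<in> verts D"
  shows "dacard_at (app_iso f D) (iso_verts f x) = dacard_at D x"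
  using digraph_iso_del_vert[OF assms(2,3)] iso_class_eq_iff[OF digraph_del_vert[OF assms(1)]]
  by (auto simp: dacard_at_def dt_app_iso[OF assms(2,3)])

lemma dadeck_app_iso:
  assumes "digraph D" "pre_digraph.digraph_isomorphism D f"
  shows "dadeck (app_iso f D) = dadeck D"
proof -
  have "inj_on (iso_verts f) (verts D)"
    using assms(2) by (rule pre_digraph.digraph_isomorphism_inj_on_verts)
  then have "dadeck (app_iso f D) =
      image_mset (dacard_at (app_iso f D) \<circ> iso_verts f) (mset_set (verts D))"
    by (simp add: dadeck_def image_mset_mset_set[symmetric] multiset.map_comp)
  also have "\<dots> = dadeck D"
    unfolding dadeck_def using dacard_at_app_iso[OF assms]
    by (intro image_mset_cong)
      (metis comp_apply digraph_def assms(1) elem_mset_set fin_digraph.finite_verts)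
  finally show ?thesis .
qed

lemma digraph_app_iso:
  assumes "digraph D" "pre_digraph.digraph_isomorphism D f"
  shows "digraph (app_iso f D)"
proof -
  interpret D: digraph D by fact
  interpret E: fin_digraph "app_iso f D" using assms(2) by (rule D.fin_digraphI_app_iso)
  show ?thesis
  proof
    fix e assume "e \<in> arcs (app_iso f D)"
    then show "tail (app_iso f D) e \<noteq> head (app_iso f D) e"
      using assms(2) D.no_loops by (auto simp: D.iso_verts_tail D.iso_verts_head)
  next
    fix e1 e2
    assume "e1 \<in> arcs (app_iso f D)" "e2 \<in> arcs (app_iso f D)"
      "arc_to_ends (app_iso f D) e1 = arc_to_ends (app_iso f D) e2"
    then show "e1 = e2"
      using assms(2) D.no_multi_arcs
      by (auto simp: arc_to_ends_def D.iso_verts_tail D.iso_verts_head)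
  qed
qed


section \<open>Isomorphic digraphs are dapasted isomorphically\<close>

lemma labeled_iso_refl:
  assumes "wf_digraph D"
  shows "labeled_iso D L D L"
  unfolding labeled_iso_def
  \<comment> \<open>\<open>app_iso\<close> takes head and tail of the image from the record, so they
    must be those of \<open>D\<close> for the image to equal \<open>D\<close>.\<close>
  by (rule exI[of _ "\<lparr>iso_verts = id, iso_arcs = id, iso_head = head D, iso_tail = tail D\<rparr>"])
    (auto simp: pre_digraph.digraph_isomorphism_def assms app_iso_def)

text \<open>Replaces the four listed digraphs by one family indexed by the set \<open>E\<close> of
  added arcs, so that later arguments need no fourfold case split. Since \<open>u\<close> and
  \<open>v\<close> are vertices already, \<open>add_arc\<close> leaves the vertex set
  unchanged.\<close>

lemma arc_extensions_eq:
  assumes "u \<in> pverts P" "v \<in> pverts P"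
  shows "arc_extensions P u v =
    (\<lambda>E. with_proj (P\<lparr>parcs := parcs P \<union> E\<rparr>)) ` Pow {(u, v), (v, u)}"
  using assms
  by (auto simp: arc_extensions_def with_proj_def pre_digraph.add_arc_def Pow_insert
      insert_absorb insert_commute)

text \<open>Here \<open>K\<close> is a copy of \<open>G\<close> on natural numbers.\<close>
lemma dapasting_in_del_arcs:
  fixes K :: "nat pair_pre_digraph"
  assumes "pair_digraph K" "u \<in> pverts K" "v \<in> pverts K" "u \<noteq> v"
    and "dadeck G = dadeck (with_proj K)" "dacard_pair G (dacard_at K u) (dacard_at K v)"
    and "digraph_iso (with_proj K) J"
  shows "dapasting_in G (dacard_at K u) (dacard_at K v)
    (K\<lparr>parcs := parcs K - {(u, v), (v, u)}\<rparr>) u v J"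
proof -
  interpret pair_digraph K by fact
  let ?P = "K\<lparr>parcs := parcs K - {(u, v), (v, u)}\<rparr>"
  \<comment> \<open>The arcs to restore are exactly those that \<open>K\<close> itself has between
    \<open>u\<close> and \<open>v\<close>; hence \<open>K\<close> is a completion of
    \<open>?P\<close>.\<close>
  have K_eq: "with_proj K =
      with_proj (?P\<lparr>parcs := parcs ?P \<union> (parcs K \<inter> {(u, v), (v, u)})\<rparr>)"
    by (intro arg_cong[where f = with_proj] pair_pre_digraph.equality) auto
  have "with_proj K \<in> (\<lambda>E. with_proj (?P\<lparr>parcs := parcs ?P \<union> E\<rparr>)) ` Pow {(u, v), (v, u)}"
    by (rule image_eqI[where x = "parcs K \<inter> {(u, v), (v, u)}"]) (use K_eq in simp_all)
  then have "with_proj K \<in> arc_extensions ?P u v"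
    using assms(2,3) by (simp add: arc_extensions_eq)
  then have compl: "completes G (dacard_at K u) (dacard_at K v) ?P u v (with_proj K)"
    using assms(5) by (simp add: completes_def dacard_at_def da_hypomorphs_def)
  have "pair_digraph ?P"
    by unfold_locales (use pair_no_loops arc_fst_in_verts arc_snd_in_verts in auto)
  \<comment> \<open>Each removed arc is incident with both \<open>u\<close> and \<open>v\<close>, so
    it disappears anyway when either vertex is deleted.\<close>
  moreover have "pre_digraph.del_vert (with_proj ?P) w = pre_digraph.del_vert (with_proj K) w"
    if "w = u \<or> w = v" for w
    using that by (auto simp: pre_digraph.del_vert_def with_proj_def)
  ultimately have "dapasting G (dacard_at K u) (dacard_at K v) ?P u v"
    using assms compl by (auto simp: dapasting_def dacard_at_def)
  then show ?thesis
    using compl assms(7) by (auto simp: dapasting_in_def completion_def)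
qed

text \<open>A copy \<open>K\<close> of \<open>G\<close> on the natural numbers is also a copy of
  \<open>H\<close>, so \<open>dapasting_in_del_arcs\<close> yields the same labeled digraph as a
  dapasting in both.\<close>

lemma dapasted_isomorphically_if_iso:
  fixes G :: "('a, 'b) pre_digraph" and H :: "('c, 'd) pre_digraph"
  assumes "digraph G" "digraph_iso G H" "dacard_pair G c d"
  shows "dapasted_isomorphically G H c d"
proof -
  obtain K :: "nat pair_pre_digraph" where "digraph_iso G (with_proj K)"
    using iso_class_nonempty[OF assms(1)] by (auto simp: iso_class_def)
  then obtain f where f: "pre_digraph.digraph_isomorphism G f" "with_proj K = app_iso f G"
    by (auto simp: digraph_iso_def)
  obtain h where h: "pre_digraph.digraph_isomorphism G h" "H = app_iso h G"
    using assms(2) by (auto simp: digraph_iso_def)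
  obtain x y where xy: "x \<in> verts G" "y \<in> verts G" "x \<noteq> y" "c = dacard_at G x" "d = dacard_at G y"
    using assms(3) by (auto simp: dacard_pair_def)
  \<comment> \<open>Membership in \<open>iso_class\<close> gives only an isomorphism; finiteness and
    looplessness of \<open>K\<close> are transported along \<open>f\<close>.\<close>
  interpret K: digraph "with_proj K" unfolding f(2) using assms(1) f(1) by (rule digraph_app_iso)
  have K: "pair_digraph K"
    by unfold_locales
      (use K.tail_in_verts K.head_in_verts K.finite_verts K.finite_arcs K.no_loops in auto)
  define u v where "u = iso_verts f x" and "v = iso_verts f y"
  have verts: "pverts K = iso_verts f ` verts G" by (metis f(2) verts_app_iso with_proj_simps(1))
  have uv: "u \<in> pverts K" "v \<in> pverts K" "u \<noteq> v"
    using xy f(1) verts pre_digraph.iso_verts_eq_iff[OF f(1)] by (auto simp: u_def v_def)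
  have cd: "c = dacard_at K u" "d = dacard_at K v"
    using xy dacard_at_app_iso[OF assms(1) f(1)] by (auto simp: u_def v_def f(2))
  have deckG: "dadeck G = dadeck (with_proj K)"
    using dadeck_app_iso[OF assms(1) f(1)] f(2) by simp
  moreover have "dadeck H = dadeck G"
    using dadeck_app_iso[OF assms(1) h(1)] h(2) by simp
  ultimately have deckH: "dadeck H = dadeck (with_proj K)" by simp
  have pairH: "dacard_pair H c d"
    unfolding dacard_pair_def
    using xy h(2) dacard_at_app_iso[OF assms(1) h(1)] pre_digraph.iso_verts_eq_iff[OF h(1)]
    by (intro bexI[of _ "iso_verts h x"] bexI[of _ "iso_verts h y"]) auto
  have KG: "digraph_iso (with_proj K) G"
    using f digraph_iso_sym unfolding digraph_iso_def by metis
  then have KH: "digraph_iso (with_proj K) H" using assms(2) by (rule digraph_iso_trans)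
  let ?P = "K\<lparr>parcs := parcs K - {(u, v), (v, u)}\<rparr>"
  have "dapasting_in G c d ?P u v G" "dapasting_in H c d ?P u v H"
    using dapasting_in_del_arcs[OF K uv] deckG deckH assms(3) pairH KG KH cd by auto
  moreover from this have "wf_digraph (with_proj ?P)"
    by (simp add: dapasting_in_def dapasting_def wf_digraph_wp_iff pair_digraph_def
        pair_fin_digraph_def)
  ultimately show ?thesis
    unfolding dapasted_isomorphically_def by (meson labeled_iso_refl)
qed


section \<open>Uniqueness of completions\<close>

text \<open>Before the insertion \<open>v\<close> is in none of the three neighborhoods of
  \<open>u\<close>; afterwards it is in exactly one, or in none if \<open>E\<close> is empty. The
  three conditions exclude each other, so the increase of the triple determines
  \<open>E\<close>.\<close>

lemma dt_insert_arcs: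
  assumes "finite (pverts P)" "v \<in> pverts P" "u \<noteq> v" "(u, v) \<notin> parcs P" "(v, u) \<notin> parcs P"
    and "E \<subseteq> {(u, v), (v, u)}"
  shows "dt (with_proj (P\<lparr>parcs := parcs P \<union> E\<rparr>)) u =
    (card (out_nbrs (with_proj P) u) + of_bool ((u, v) \<in> E \<and> (v, u) \<notin> E),
     card (in_nbrs (with_proj P) u) + of_bool ((v, u) \<in> E \<and> (u, v) \<notin> E),
     card (strong_nbrs (with_proj P) u) + of_bool ((u, v) \<in> E \<and> (v, u) \<in> E))"
proof -
  let ?Y = "with_proj (P\<lparr>parcs := parcs P \<union> E\<rparr>)"
  have "out_nbrs ?Y u =
      (if (u, v) \<in> E \<and> (v, u) \<notin> E then insert v else id) (out_nbrs (with_proj P) u)"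
    "in_nbrs ?Y u =
      (if (v, u) \<in> E \<and> (u, v) \<notin> E then insert v else id) (in_nbrs (with_proj P) u)"
    "strong_nbrs ?Y u =
      (if (u, v) \<in> E \<and> (v, u) \<in> E then insert v else id) (strong_nbrs (with_proj P) u)"
    using assms by (auto simp: out_nbrs_def in_nbrs_def strong_nbrs_def)
  then show ?thesis
    using assms(1,4,5) by (auto simp: dt_def out_nbrs_def in_nbrs_def strong_nbrs_def)
qed

text \<open>Arcs of a pair digraph are their own end pairs, so a vertex map induces the arc map
  \<open>map_prod g g\<close>.\<close>

lemma digraph_iso_with_projI:
  assumes "pair_wf_digraph P" "inj_on g (pverts P)" "pverts Q = g ` pverts P"
    and "parcs Q = map_prod g g ` parcs P"
  shows "digraph_iso (with_proj P) (with_proj Q)"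
proof -
  interpret pair_wf_digraph P by fact
  define h where "h = \<lparr>iso_verts = g, iso_arcs = map_prod g g, iso_head = snd, iso_tail = fst\<rparr>"
  have "inj_on (map_prod g g) (parcs P)"
    using assms(2) arc_fst_in_verts arc_snd_in_verts
    by (auto intro!: inj_onI dest!: inj_onD[OF assms(2)] simp: in_arcsD1 in_arcsD2)
  then have "pre_digraph.digraph_isomorphism (with_proj P) h"
    using assms by (auto simp: pre_digraph.digraph_isomorphism_def h_def wf_digraph_wp_iff)
  moreover have "with_proj Q = app_iso h (with_proj P)"
    using assms by (simp add: app_iso_def with_proj_def h_def)
  ultimately show ?thesis unfolding digraph_iso_def by blast
qed

text \<open>The isomorphism \<open>f\<close> equates the triples of \<open>u\<close> and
  \<open>s\<close> before the insertion. Equal triples afterwards thus mean equal increases, which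
  forces \<open>F\<close> to be the image of \<open>E\<close>; the vertex map of \<open>f\<close>
  then respects the added arcs too.\<close>

lemma digraph_iso_insert_arcs:
  assumes P: "pair_digraph P" "u \<in> pverts P" "v \<in> pverts P" "u \<noteq> v"
      "(u, v) \<notin> parcs P" "(v, u) \<notin> parcs P" "E \<subseteq> {(u, v), (v, u)}"
    and Q: "pair_digraph Q" "s \<in> pverts Q" "t \<in> pverts Q" "s \<noteq> t"
      "(s, t) \<notin> parcs Q" "(t, s) \<notin> parcs Q" "F \<subseteq> {(s, t), (t, s)}"
    and f: "pre_digraph.digraph_isomorphism (with_proj P) f" "with_proj Q = app_iso f (with_proj P)"
      "iso_verts f u = s" "iso_verts f v = t"
    and dt: "dt (with_proj (P\<lparr>parcs := parcs P \<union> E\<rparr>)) u = dt (with_proj (Q\<lparr>parcs := parcs Q \<union> F\<rparr>)) s"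
  shows "digraph_iso (with_proj (P\<lparr>parcs := parcs P \<union> E\<rparr>)) (with_proj (Q\<lparr>parcs := parcs Q \<union> F\<rparr>))"
proof -
  interpret P: pair_digraph P by fact
  interpret Q: pair_digraph Q by fact
  let ?g = "iso_verts f"
  have "dt (with_proj P) u = dt (with_proj Q) s"
    using dt_app_iso[OF f(1), of u] P(2) f(2,3) by simp
  then have "((u, v) \<in> E \<and> (v, u) \<notin> E) = ((s, t) \<in> F \<and> (t, s) \<notin> F)"
    "((v, u) \<in> E \<and> (u, v) \<notin> E) = ((t, s) \<in> F \<and> (s, t) \<notin> F)"
    "((u, v) \<in> E \<and> (v, u) \<in> E) = ((s, t) \<in> F \<and> (t, s) \<in> F)"
    using dt[unfolded dt_insert_arcs[OF P.pair_finite_verts P(3-7)]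
      dt_insert_arcs[OF Q.pair_finite_verts Q(3-7)]]
    unfolding dt_def prod.inject by (simp_all only: add_left_cancel of_bool_eq_iff)
  \<comment> \<open>An arc belongs to the added set iff it was added alone or as half of a
    biarc.\<close>
  then have iff: "(u, v) \<in> E \<longleftrightarrow> (s, t) \<in> F" "(v, u) \<in> E \<longleftrightarrow> (t, s) \<in> F"
    by blast+
  have "F = map_prod ?g ?g ` E"
  proof
    show "F \<subseteq> map_prod ?g ?g ` E"
      using Q(7) iff f(3,4) by (auto intro: rev_image_eqI)
    show "map_prod ?g ?g ` E \<subseteq> F"
      using P(7) iff f(3,4) by auto
  qed
  moreover have "parcs Q = map_prod ?g ?g ` parcs P"
    using P.arcs_ends_app_iso_eq[OF f(1)] f(2)
    by (metis map_prod_def with_proj_simps(3))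
  moreover have "pverts Q = ?g ` pverts P"
    by (metis f(2) verts_app_iso with_proj_simps(1))
  moreover have "inj_on ?g (pverts P)"
    using pre_digraph.digraph_isomorphism_inj_on_verts[OF f(1)] by simp
  moreover have "pair_wf_digraph (P\<lparr>parcs := parcs P \<union> E\<rparr>)"
    by unfold_locales (use P(2,3,7) in \<open>auto simp: P.in_arcsD1 P.in_arcsD2\<close>)
  ultimately show ?thesis
    by (intro digraph_iso_with_projI[where g = ?g]) (auto simp: image_Un)
qed

lemma digraph_iso_if_dapasted_isomorphically:
  assumes "dapasted_isomorphically G H c d"
  shows "digraph_iso G H"
proof -
  obtain P u v Q s t where
    P: "dapasting_in G c d P u v G" and Q: "dapasting_in H c d Q s t H" and
    iso: "labeled_iso (with_proj P) (dapasting_labels c d u v)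
      (with_proj Q) (dapasting_labels c d s t)"
    using assms unfolding dapasted_isomorphically_def by blast
  have P': "pair_digraph P" "u \<in> pverts P" "v \<in> pverts P" "u \<noteq> v" "(u, v) \<notin> parcs P" "(v, u) \<notin> parcs P"
    using P by (auto simp: dapasting_in_def dapasting_def)
  have Q': "pair_digraph Q" "s \<in> pverts Q" "t \<in> pverts Q" "s \<noteq> t" "(s, t) \<notin> parcs Q" "(t, s) \<notin> parcs Q"
    using Q by (auto simp: dapasting_in_def dapasting_def)
  obtain Y where Y: "completes G c d P u v Y" "digraph_iso Y G"
    using P by (auto simp: dapasting_in_def completion_def)
  obtain Z where Z: "completes H c d Q s t Z" "digraph_iso Z H"
    using Q by (auto simp: dapasting_in_def completion_def)
  obtain E where E: "E \<subseteq> {(u, v), (v, u)}" "Y = with_proj (P\<lparr>parcs := parcs P \<union> E\<rparr>)"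
    using Y(1) P' by (auto simp: completes_def arc_extensions_eq)
  obtain F where F: "F \<subseteq> {(s, t), (t, s)}" "Z = with_proj (Q\<lparr>parcs := parcs Q \<union> F\<rparr>)"
    using Z(1) Q' by (auto simp: completes_def arc_extensions_eq)
  have dts: "dt Y u = snd c" "dt Z s = snd c" "dt Z t = snd d"
    using Y(1) Z(1) by (auto simp: completes_def)
  obtain f where f: "pre_digraph.digraph_isomorphism (with_proj P) f"
      "with_proj Q = app_iso f (with_proj P)"
    and lab: "\<forall>w \<in> pverts P. dapasting_labels c d s t (iso_verts f w) = dapasting_labels c d u v w"
    using iso by (auto simp: labeled_iso_def)
  have labs: "dapasting_labels c d s t (iso_verts f u) = Some (snd c)"
    "dapasting_labels c d s t (iso_verts f v) = Some (snd d)"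
    using lab P' by (auto simp: dapasting_labels_def)
  \<comment> \<open>If the two triples agree, the labels alone would allow both vertices to have the
    same image.\<close>
  have "iso_verts f u \<noteq> iso_verts f v"
    using pre_digraph.iso_verts_eq_iff[OF f(1)] P' by auto
  \<comment> \<open>All vertices other than \<open>s\<close> and \<open>t\<close> carry
    \<open>None\<close>, so \<open>f\<close> maps the labeled pair onto the labeled pair, and a swap
    requires equal triples.\<close>
  with labs consider "iso_verts f u = s" "iso_verts f v = t"
    | "iso_verts f u = t" "iso_verts f v = s" "snd c = snd d"
    by (auto simp: dapasting_labels_def split: if_splits)
  then have "digraph_iso Y Z"
  proof cases
    case 1
    then show ?thesis
      using digraph_iso_insert_arcs[OF P' E(1) Q' F(1) f] dts E(2) F(2) by simp
  next
    case 2
    \<comment> \<open>The previous lemma is applied with \<open>s\<close> and \<open>t\<close>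
      exchanged; its triple condition becomes \<open>dt Y u = dt Z t\<close>, which holds because
      \<open>snd c = snd d\<close>.\<close>
    have "F \<subseteq> {(t, s), (s, t)}" using F(1) by auto
    with 2 show ?thesis
      using digraph_iso_insert_arcs[OF P' E(1) Q'(1,3,2) Q'(4)[symmetric] Q'(6,5) _ f]
        dts E(2) F(2) by simp
  qed
  then show ?thesis
    using Y(2) Z(2) digraph_iso_sym digraph_iso_trans by metis
qed

theorem theorem5p11:
  fixes G :: "('a, 'b) pre_digraph" and H :: "('c, 'd) pre_digraph"
  assumes "digraph G" and "digraph H"
    and "2 \<le> card (verts G)"
    and "da_hypomorphs G H"
  shows "((\<forall>c d. dacard_pair G c d \<longrightarrow> dapasted_isomorphically G H c d) \<or>
          (\<forall>c d. dacard_pair G c d \<longrightarrow> \<not> dapasted_isomorphically G H c d)) \<and>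
         ((\<forall>c d. dacard_pair G c d \<longrightarrow> dapasted_isomorphically G H c d) \<longrightarrow> digraph_iso G H) \<and>
         ((\<forall>c d. dacard_pair G c d \<longrightarrow> \<not> dapasted_isomorphically G H c d) \<longrightarrow> \<not> digraph_iso G H)"
proof -
  \<comment> \<open>Two distinct vertices provide at least one pair of dacards, so neither
    alternative holds vacuously. As every pair is dapasted isomorphically exactly when
    \<open>G\<close> and \<open>H\<close> are isomorphic, all claims follow.\<close>
  obtain x y where "x \<in> verts G" "y \<in> verts G" "x \<noteq> y"
    using assms(3) by (auto simp: card_le_Suc_iff numeral_2_eq_2)
  then have "dacard_pair G (dacard_at G x) (dacard_at G y)"
    unfolding dacard_pair_def by blast
  then show ?thesis
    using dapasted_isomorphically_if_iso[OF assms(1)] digraph_iso_if_dapasted_isomorphically[of G H]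
    by blast
qed

end
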